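(* Let $G\subset\mathbb{R}^N$ be a bounded open domain. Let $\varphi:G\times\mathbb{R}\to[0,+\infty)$ be a measurable-convex integrand with $\varphi(x,0)=0$ for each $x\in G$, and let $\bar\beta(x,\cdot)=\partial\varphi(x,\cdot)$. Assume that for each $C>0$ the function $M_C(x)=\sup\{|u|:\ u\in\bar\beta(x,v),\ |v|\le C\}$ belongs to $L^2(G)$. Let $A:\mathrm{Dom}(A)\subset L^1(G)\to L^1(G)$ be a linear operator such that: (a) $\mathrm{Dom}(A)$ is dense in $L^1(G)$ and $(I+\lambda A)^{-1}$ is a contraction on $L^1(G)$ for each $\lambda>0$; (b) there is a $c>0$ such that $c\|v\|_{L^1}\le\|Av\|_{L^1}$ for all $v\in\mathrm{Dom}(A)$; (c) $\sup_G (I+\lambda A)^{-1}f\le(\sup_G f)^+$ for each $f\in L^1(G)$ and $\lambda>0$. Let $f\in L^1(G)$, and let $v\in\mathrm{Dom}(A)$, $u\in L^1(G)$ be the solution of $u+Av=f$, $u(x)\in\bar\beta(x,v(x))$ for a.e. $x\in G$. Let $k\ge0$ and let $b$ be a measurable function on $G$ with $b(x)\in\bar\beta(x,k)$ for $x\in G$. If $f(x)\le b(x)$ for a.e. $x\in G$, then $v(x)\le k$ and $u(x)\le b(x)$ for a.e. $x\in G$.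
   Context: A function $\varphi:G\times\mathbb{R}\to(-\infty,+\infty]$ is a measurable-convex integrand if for each $x\in G$ the function $\varphi(x,\cdot)$ is proper, lower semicontinuous and convex, and for each $\xi\in\mathbb{R}$ the function $x\mapsto\varphi(x,\xi)$ is measurable. The subgradient is taken in the second variable: $u^*\in\partial\varphi(x,v)$ iff $u^*(w-v)\le\varphi(x,w)-\varphi(x,v)$ for all $w\in\mathbb{R}$. "Contraction" means nonexpansive, and in (a) the inverse $(I+\lambda A)^{-1}$ is defined on all of $L^1(G)$. $\sup_G$ is the essential supremum; $r^+=\max(r,0)$. Under these hypotheses the solution pair $(u,v)$ exists and is unique for each $f\in L^1(G)$. *)

theory Defs
  imports "HOL-Probability.Essential_Supremum"
begin

section \<open>Measurable-convex integrands and subdifferentials\<close>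

text \<open>Convexity is spelled out because the library's \<open>convex_on\<close> is for real-valued functions.
  In \<^typ>\<open>ereal\<close>, \<open>0 * \<infinity> = 0\<close>, so the endpoints \<open>t = 0\<close> and \<open>t = 1\<close> are harmless.\<close>

definition proper_lsc_convex :: "(real \<Rightarrow> ereal) \<Rightarrow> bool" where
  "proper_lsc_convex g \<longleftrightarrow>
     (\<forall>r. g r \<noteq> -\<infinity>) \<and> (\<exists>r. g r \<noteq> \<infinity>) \<and>
     (\<forall>r. g r \<le> Liminf (at r) g) \<and>
     (\<forall>r s t. 0 \<le> t \<longrightarrow> t \<le> 1 \<longrightarrow>
        g ((1 - t) * r + t * s) \<le> ereal (1 - t) * g r + ereal t * g s)"

definition measurable_convex_integrand ::
  "(real ^ 'n) set \<Rightarrow> (real ^ 'n \<Rightarrow> real \<Rightarrow> ereal) \<Rightarrow> bool" where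
  "measurable_convex_integrand G \<phi> \<longleftrightarrow>
     (\<forall>x\<in>G. proper_lsc_convex (\<phi> x)) \<and>
     (\<forall>\<xi>. (\<lambda>x. \<phi> x \<xi>) \<in> borel_measurable (lebesgue_on G))"

text \<open>For proper \<open>g\<close>, a point \<open>v\<close> with \<open>g v = \<infinity>\<close> has empty subdifferential: take \<open>w\<close> with
  \<open>g w\<close> finite, so that \<open>g w - g v = -\<infinity>\<close>.\<close>

definition subdifferential :: "(real \<Rightarrow> ereal) \<Rightarrow> real \<Rightarrow> real set" where
  "subdifferential g v = {u. \<forall>w. ereal (u * (w - v)) \<le> g w - g v}"

text \<open>The supremum is taken in \<^typ>\<open>ennreal\<close>, so no boundedness is presupposed.\<close>

definition graph_bound :: "(real \<Rightarrow> real set) \<Rightarrow> real \<Rightarrow> ennreal" where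
  "graph_bound \<gamma> C = Sup {ennreal \<bar>u\<bar> | u v. u \<in> \<gamma> v \<and> \<bar>v\<bar> \<le> C}"

definition in_L2 :: "'a measure \<Rightarrow> ('a \<Rightarrow> ennreal) \<Rightarrow> bool" where
  "in_L2 M h \<longleftrightarrow> h \<in> borel_measurable M \<and> (\<integral>\<^sup>+x. (h x)\<^sup>2 \<partial>M) < \<infinity>"

section \<open>Operators in \<open>L\<^sup>1\<close>\<close>

text \<open>Elements of \<open>L\<^sup>1\<close> are handled through representatives: equality in \<open>L\<^sup>1\<close> is equality almost
  everywhere, and domains and operators are required to respect it.\<close>

definition L1 :: "'a measure \<Rightarrow> ('a \<Rightarrow> real) set" where
  "L1 M = {f. integrable M f}"

definition L1_norm :: "'a measure \<Rightarrow> ('a \<Rightarrow> real) \<Rightarrow> real" where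
  "L1_norm M f = (\<integral>x. \<bar>f x\<bar> \<partial>M)"

definition L1_linear_operator ::
  "'a measure \<Rightarrow> ('a \<Rightarrow> real) set \<Rightarrow> (('a \<Rightarrow> real) \<Rightarrow> 'a \<Rightarrow> real) \<Rightarrow> bool" where
  "L1_linear_operator M D A \<longleftrightarrow>
     D \<subseteq> L1 M \<and> (\<forall>v\<in>D. A v \<in> L1 M) \<and>
     (\<forall>v\<in>D. \<forall>w\<in>L1 M. (AE x in M. v x = w x) \<longrightarrow> w \<in> D \<and> (AE x in M. A v x = A w x)) \<and>
     (\<lambda>x. 0) \<in> D \<and>
     (\<forall>v\<in>D. \<forall>w\<in>D. (\<lambda>x. v x + w x) \<in> D \<and>
        (AE x in M. A (\<lambda>x. v x + w x) x = A v x + A w x)) \<and>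
     (\<forall>a. \<forall>v\<in>D. (\<lambda>x. a * v x) \<in> D \<and> (AE x in M. A (\<lambda>x. a * v x) x = a * A v x))"

definition L1_dense :: "'a measure \<Rightarrow> ('a \<Rightarrow> real) set \<Rightarrow> bool" where
  "L1_dense M D \<longleftrightarrow> (\<forall>f\<in>L1 M. \<forall>\<epsilon>>0. \<exists>v\<in>D. L1_norm M (\<lambda>x. f x - v x) < \<epsilon>)"

text \<open>The graph of \<open>(I + \<mu>A)\<^sup>-\<^sup>1\<close>: here \<open>v\<close> is a representative of \<open>(I + \<mu>A)\<^sup>-\<^sup>1 f\<close>.\<close>

definition resolvent ::
  "'a measure \<Rightarrow> ('a \<Rightarrow> real) set \<Rightarrow> (('a \<Rightarrow> real) \<Rightarrow> 'a \<Rightarrow> real) \<Rightarrow> real \<Rightarrow>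
   ('a \<Rightarrow> real) \<Rightarrow> ('a \<Rightarrow> real) \<Rightarrow> bool" where
  "resolvent M D A \<mu> f v \<longleftrightarrow> v \<in> D \<and> (AE x in M. v x + \<mu> * A v x = f x)"

text \<open>\<open>(I + \<mu>A)\<^sup>-\<^sup>1\<close> is a single-valued nonexpansive map defined on all of \<open>L\<^sup>1\<close>.\<close>

definition resolvent_contraction ::
  "'a measure \<Rightarrow> ('a \<Rightarrow> real) set \<Rightarrow> (('a \<Rightarrow> real) \<Rightarrow> 'a \<Rightarrow> real) \<Rightarrow> real \<Rightarrow> bool" where
  "resolvent_contraction M D A \<mu> \<longleftrightarrow>
     (\<forall>f\<in>L1 M. \<exists>v. resolvent M D A \<mu> f v) \<and>
     (\<forall>f\<in>L1 M. \<forall>v w. resolvent M D A \<mu> f v \<longrightarrow> resolvent M D A \<mu> f w \<longrightarrow> (AE x in M. v x = w x)) \<and>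
     (\<forall>f\<in>L1 M. \<forall>g\<in>L1 M. \<forall>v w. resolvent M D A \<mu> f v \<longrightarrow> resolvent M D A \<mu> g w \<longrightarrow>
        L1_norm M (\<lambda>x. v x - w x) \<le> L1_norm M (\<lambda>x. f x - g x))"

text \<open>The essential supremum of an \<open>L\<^sup>1\<close> function may be infinite, hence the values in \<^typ>\<open>ereal\<close>.\<close>

definition ess_sup :: "'a measure \<Rightarrow> ('a \<Rightarrow> real) \<Rightarrow> ereal" where
  "ess_sup M f = esssup M (\<lambda>x. ereal (f x))"

end

(* The resolvents J t = (I + t A)^-1 are positive and preserve the bound g <= k for k >= 0. Writing
   w for the positive part of v - k, this gives J t v <= k + J t w, so the Yosida approximants
   A_t = (I - J t) / t satisfy the Kato inequality A_t w <= 1_{v > k} A_t v, while A_t v = J t (A v)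
   tends to A v in L1 by density of the domain. Monotonicity of the graph gives
   A v = f - u <= b - u <= 0 on {v > k}, so A_t w is at most an error tending to 0 in L1, and
   coercivity forces w = 0. Once v <= k, the A_t v are nonnegative on {v = k}, hence so is A v, and
   there u = f - A v <= b. *)

theory Submission
  imports Defs
begin

section \<open>Elementary estimates for the L1 norm\<close>

lemma L1_norm_mono:
  assumes "f \<in> L1 M" "g \<in> L1 M" "AE x in M. \<bar>f x\<bar> \<le> \<bar>g x\<bar>"
  shows "L1_norm M f \<le> L1_norm M g"
  using assms unfolding L1_norm_def L1_def by (intro integral_mono_AE) auto

lemma L1_norm_cong_AE:
  assumes "f \<in> L1 M" "g \<in> L1 M" "AE x in M. f x = g x"
  shows "L1_norm M f = L1_norm M g"
  using assms by (intro antisym L1_norm_mono) auto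

lemma L1_norm_triangle:
  assumes "f \<in> L1 M" "g \<in> L1 M"
  shows "L1_norm M (\<lambda>x. f x + g x) \<le> L1_norm M f + L1_norm M g"
proof -
  have "L1_norm M (\<lambda>x. f x + g x) \<le> (\<integral>x. \<bar>f x\<bar> + \<bar>g x\<bar> \<partial>M)"
    using assms unfolding L1_norm_def L1_def by (intro integral_mono) auto
  then show ?thesis
    using assms unfolding L1_norm_def L1_def by (simp add: Bochner_Integration.integral_add)
qed

lemma L1_norm_triangle_diff:
  assumes "f \<in> L1 M" "g \<in> L1 M"
  shows "L1_norm M (\<lambda>x. f x - g x) \<le> L1_norm M f + L1_norm M g"
  using L1_norm_triangle[of f M "\<lambda>x. - g x"] assms by (simp add: L1_def L1_norm_def)

lemma L1_norm_cmult: "L1_norm M (\<lambda>x. a * f x) = \<bar>a\<bar> * L1_norm M f"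
  unfolding L1_norm_def by (simp add: abs_mult)

lemma L1_norm_nonneg: "0 \<le> L1_norm M f"
  unfolding L1_norm_def by simp

text \<open>Passage to the limit without sequences: each use bounds a norm by a fixed multiple of a
  Yosida error.\<close>

lemma L1_norm_arbitrarily_small_imp_AE_eq_0:
  assumes "f \<in> L1 M" "0 \<le> C" "\<And>e. e > 0 \<Longrightarrow> L1_norm M f \<le> C * e"
  shows "AE x in M. f x = 0"
proof -
  have "L1_norm M f \<le> 0"
  proof (rule field_le_epsilon)
    fix e :: real
    assume "e > 0"
    \<comment> \<open>Dividing by \<open>C + 1\<close> instead of \<open>C\<close> covers
      \<open>C = 0\<close>.\<close>
    then have "L1_norm M f \<le> C * (e / (C + 1))"
      using assms(2) by (intro assms(3)) simp
    also have "\<dots> \<le> 0 + e"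
      using \<open>e > 0\<close> \<open>0 \<le> C\<close> by (simp add: field_simps)
    finally show "L1_norm M f \<le> 0 + e" .
  qed
  then have "(\<integral>x. \<bar>f x\<bar> \<partial>M) = 0"
    using L1_norm_nonneg[of M f] unfolding L1_norm_def by (rule antisym)
  then show ?thesis
    using assms(1) by (subst (asm) integral_nonneg_eq_0_iff_AE) (auto simp: L1_def)
qed

text \<open>Adding the two subgradient inequalities cancels the values of \<open>g\<close>.
  Strictness of \<open>r < s\<close> matters: two subgradients at one point need not be
  ordered.\<close>

lemma subdifferential_mono:
  assumes "a \<in> subdifferential (\<lambda>s. ereal (g s)) r"
    and "b \<in> subdifferential (\<lambda>s. ereal (g s)) s"
    and "r < s"
  shows "a \<le> b"
proof -
  have "a * (s - r) \<le> g s - g r" "b * (r - s) \<le> g r - g s"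
    using assms unfolding subdifferential_def by auto
  then have "(b - a) * (s - r) \<ge> 0"
    by (simp add: algebra_simps)
  with \<open>r < s\<close> show ?thesis
    by (simp add: zero_le_mult_iff)
qed

section \<open>Linear operators in L1 modulo null sets\<close>

locale sub_markovian_operator =
  fixes M :: "'a measure" and D :: "('a \<Rightarrow> real) set" and A :: "('a \<Rightarrow> real) \<Rightarrow> 'a \<Rightarrow> real"
  assumes linear: "L1_linear_operator M D A"
    and dense: "L1_dense M D"
    and contraction: "\<And>t. t > 0 \<Longrightarrow> resolvent_contraction M D A t"
    and sup_bound: "\<And>t g w. t > 0 \<Longrightarrow> g \<in> L1 M \<Longrightarrow> resolvent M D A t g w \<Longrightarrow>
      ess_sup M w \<le> max (ess_sup M g) 0"
begin

lemma dom_L1: "v \<in> D \<Longrightarrow> v \<in> L1 M"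
  and op_L1: "v \<in> D \<Longrightarrow> A v \<in> L1 M"
  and dom_cong: "v \<in> D \<Longrightarrow> w \<in> L1 M \<Longrightarrow> AE x in M. v x = w x \<Longrightarrow> w \<in> D"
  and op_cong: "v \<in> D \<Longrightarrow> w \<in> L1 M \<Longrightarrow> AE x in M. v x = w x \<Longrightarrow> AE x in M. A v x = A w x"
  and dom_add: "v \<in> D \<Longrightarrow> w \<in> D \<Longrightarrow> (\<lambda>x. v x + w x) \<in> D"
  and op_add: "v \<in> D \<Longrightarrow> w \<in> D \<Longrightarrow> AE x in M. A (\<lambda>x. v x + w x) x = A v x + A w x"
  and dom_cmult: "v \<in> D \<Longrightarrow> (\<lambda>x. a * v x) \<in> D"
  and op_cmult: "v \<in> D \<Longrightarrow> AE x in M. A (\<lambda>x. a * v x) x = a * A v x"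
  and dom_0: "(\<lambda>x. 0) \<in> D"
  using linear unfolding L1_linear_operator_def by blast+

lemma op_0: "AE x in M. A (\<lambda>x. 0) x = 0"
  using op_cmult[OF dom_0, of 0] by simp

lemma dom_diff:
  assumes "v \<in> D" "w \<in> D"
  shows "(\<lambda>x. v x - w x) \<in> D"
  using dom_add[OF assms(1) dom_cmult[OF assms(2), of "-1"]] by simp

lemma op_diff:
  assumes "v \<in> D" "w \<in> D"
  shows "AE x in M. A (\<lambda>x. v x - w x) x = A v x - A w x"
  using op_add[OF assms(1) dom_cmult[OF assms(2), of "-1"]] op_cmult[OF assms(2), of "-1"]
  by eventually_elim simp

section \<open>Resolvents: contraction, order, commutation with \<open>A\<close>\<close>

abbreviation res :: "real \<Rightarrow> ('a \<Rightarrow> real) \<Rightarrow> ('a \<Rightarrow> real) \<Rightarrow> bool" where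
  "res \<equiv> resolvent M D A"

lemma resD:
  assumes "res t g w"
  shows "w \<in> D" "AE x in M. w x + t * A w x = g x"
  using assms unfolding resolvent_def by auto

lemma res_exists:
  assumes "t > 0" "g \<in> L1 M"
  obtains w where "res t g w"
  using contraction[OF assms(1)] assms(2) unfolding resolvent_contraction_def by blast

lemma res_dist_le:
  assumes "t > 0" "g \<in> L1 M" "h \<in> L1 M" "res t g v" "res t h w"
  shows "L1_norm M (\<lambda>x. v x - w x) \<le> L1_norm M (\<lambda>x. g x - h x)"
  using contraction[OF assms(1)] assms unfolding resolvent_contraction_def by blast

lemma res_0: "res t (\<lambda>x. 0) (\<lambda>x. 0)"
  unfolding resolvent_def using op_0 dom_0 by auto

lemma res_norm_le:
  assumes "t > 0" "g \<in> L1 M" "res t g w"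
  shows "L1_norm M w \<le> L1_norm M g"
  using res_dist_le[OF assms(1,2) _ assms(3) res_0] by (simp add: L1_def)

lemma res_diff:
  assumes "res t g v" "res t h w"
  shows "res t (\<lambda>x. g x - h x) (\<lambda>x. v x - w x)"
proof -
  have "AE x in M. (v x - w x) + t * A (\<lambda>x. v x - w x) x = g x - h x"
    using resD(2)[OF assms(1)] resD(2)[OF assms(2)] op_diff[OF resD(1)[OF assms(1)] resD(1)[OF assms(2)]]
    by eventually_elim (simp add: right_diff_distrib)
  then show ?thesis
    using dom_diff[OF resD(1)[OF assms(1)] resD(1)[OF assms(2)]] unfolding resolvent_def by simp
qed

text \<open>The positive part in the sup bound is harmless because \<open>k\<close> is
  nonnegative.\<close>

lemma res_le:
  assumes "t > 0" "g \<in> L1 M" "res t g w" "0 \<le> k" "AE x in M. g x \<le> k"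
  shows "AE x in M. w x \<le> k"
proof -
  have "ess_sup M g \<le> ereal k"
    unfolding ess_sup_def using assms(2,5) by (intro esssup_I) (auto simp: L1_def)
  then have le: "ess_sup M w \<le> ereal k"
    using sup_bound[OF assms(1-3)] \<open>0 \<le> k\<close> by (auto elim!: order_trans)
  have "AE x in M. ereal (w x) \<le> ess_sup M w"
    unfolding ess_sup_def by (rule esssup_AE)
  then show ?thesis
  proof eventually_elim
    fix x assume "ereal (w x) \<le> ess_sup M w"
    from order_trans[OF this le] show "w x \<le> k" by simp
  qed
qed

text \<open>By linearity this is the upper bound \<open>0\<close> for the resolvent of
  \<open>g - h\<close>.\<close>

lemma res_mono:
  assumes "t > 0" "g \<in> L1 M" "h \<in> L1 M" "res t g v" "res t h w" "AE x in M. g x \<le> h x"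
  shows "AE x in M. v x \<le> w x"
proof -
  have "AE x in M. v x - w x \<le> 0"
    using assms by (intro res_le[OF _ _ res_diff[OF assms(4,5)]]) (auto simp: L1_def)
  then show ?thesis by simp
qed

lemma res_nonneg:
  assumes "t > 0" "g \<in> L1 M" "res t g w" "AE x in M. 0 \<le> g x"
  shows "AE x in M. 0 \<le> w x"
  using res_mono[OF assms(1) _ assms(2) res_0 assms(3,4)] by (simp add: L1_def)

text \<open>The resolvent equation reads \<open>A p = (v - p) / t\<close>, a combination of elements
  of \<open>D\<close>; applying \<open>A\<close> to it gives the claim. So the Yosida approximant
  \<open>A p\<close> of \<open>v\<close> is the resolvent of \<open>A v\<close>.\<close>

lemma res_op:
  assumes "t > 0" "v \<in> D" "res t v p"
  shows "res t (A v) (A p)"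
proof -
  note p = resD[OF assms(3)]
  let ?d = "\<lambda>x. v x - p x"
  have d: "?d \<in> D" by (rule dom_diff[OF assms(2) p(1)])
  have eq: "AE x in M. (1 / t) * ?d x = A p x"
    using p(2) by eventually_elim (use \<open>t > 0\<close> in \<open>simp add: field_simps\<close>)
  have "A p \<in> D"
    by (rule dom_cong[OF dom_cmult[OF d] op_L1[OF p(1)] eq])
  moreover have "AE x in M. A p x + t * A (A p) x = A v x"
    using op_cong[OF dom_cmult[OF d] op_L1[OF p(1)] eq] op_cmult[OF d, of "1 / t"] op_diff[OF assms(2) p(1)]
    by eventually_elim (use \<open>t > 0\<close> in simp)
  ultimately show ?thesis unfolding resolvent_def by simp
qed

text \<open>Strong convergence of the resolvents to the identity, in the form of one good
  \<open>t\<close>. For \<open>d\<close> in \<open>D\<close> with resolvent \<open>p\<close>,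
  \<open>d - p = t * A p\<close> has norm at most \<open>t\<close> times that of \<open>A d\<close>;
  density and contraction carry this over to \<open>g\<close>, at a cost of \<open>e / 3\<close> for
  each of three terms.\<close>

lemma res_approx:
  assumes g: "g \<in> L1 M" and "e > 0"
  obtains t where "0 < t" "t \<le> 1" "\<And>w. res t g w \<Longrightarrow> L1_norm M (\<lambda>x. w x - g x) < e"
proof -
  obtain d where d: "d \<in> D" "L1_norm M (\<lambda>x. g x - d x) < e / 3"
    using dense g \<open>e > 0\<close> unfolding L1_dense_def by (metis zero_less_divide_iff zero_less_numeral)
  define n where "n = L1_norm M (A d)"
  have n: "0 \<le> n" unfolding n_def by (rule L1_norm_nonneg)
  \<comment> \<open>The second entry makes \<open>t * n\<close> at most \<open>e / 3\<close>, with
    \<open>n + 1\<close> guarding against \<open>n = 0\<close>; the cap at 1 later allows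
    \<open>t * h\<close> to be bounded by \<open>h\<close>.\<close>
  define t where "t = min 1 (e / (3 * (n + 1)))"
  have t: "0 < t" "t \<le> 1"
    using \<open>e > 0\<close> n by (auto simp: t_def)
  have "t * n \<le> e / (3 * (n + 1)) * n"
    using n by (intro mult_right_mono) (auto simp: t_def)
  also have "\<dots> \<le> e / 3"
    using n \<open>e > 0\<close> by (simp add: field_simps)
  finally have tn: "t * n \<le> e / 3" .
  have "L1_norm M (\<lambda>x. w x - g x) < e" if w: "res t g w" for w
  proof -
    obtain p where p: "res t d p"
      using res_exists[OF t(1) dom_L1[OF d(1)]] .
    note L = g[unfolded L1_def] dom_L1[OF d(1), unfolded L1_def] dom_L1[OF resD(1)[OF p], unfolded L1_def]
      dom_L1[OF resD(1)[OF w], unfolded L1_def] op_L1[OF resD(1)[OF p], unfolded L1_def]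
    have "L1_norm M (\<lambda>x. d x - p x) = L1_norm M (\<lambda>x. t * A p x)"
      using resD(2)[OF p] L by (intro L1_norm_cong_AE) (auto simp: L1_def elim!: eventually_mono)
    also have "\<dots> \<le> t * n"
      using res_norm_le[OF t(1) op_L1[OF d(1)] res_op[OF t(1) d(1) p]] t(1)
      by (simp add: L1_norm_cmult n_def)
    finally have "L1_norm M (\<lambda>x. d x - p x) \<le> e / 3" using tn by simp
    moreover have "L1_norm M (\<lambda>x. w x - p x) < e / 3"
      using res_dist_le[OF t(1) g dom_L1[OF d(1)] w p] d(2) by simp
    moreover have "L1_norm M (\<lambda>x. w x - g x) = L1_norm M (\<lambda>x. ((w x - p x) - (d x - p x)) - (g x - d x))"
      by simp
    moreover have "\<dots> \<le> L1_norm M (\<lambda>x. (w x - p x) - (d x - p x)) + L1_norm M (\<lambda>x. g x - d x)"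
      using L by (intro L1_norm_triangle_diff) (auto simp: L1_def)
    moreover have "L1_norm M (\<lambda>x. (w x - p x) - (d x - p x)) \<le>
        L1_norm M (\<lambda>x. w x - p x) + L1_norm M (\<lambda>x. d x - p x)"
      using L by (intro L1_norm_triangle_diff) (auto simp: L1_def)
    ultimately show ?thesis using d(2) by linarith
  qed
  with t that show thesis by blast
qed

lemma yosida_approx:
  assumes v: "v \<in> D" and "e > 0"
  obtains t p where "0 < t" "t \<le> 1" "res t v p" "L1_norm M (\<lambda>x. A p x - A v x) < e"
proof -
  obtain t where t: "0 < t" "t \<le> 1" "\<And>w. res t (A v) w \<Longrightarrow> L1_norm M (\<lambda>x. w x - A v x) < e"
    using res_approx[OF op_L1[OF v] \<open>e > 0\<close>] by blast
  obtain p where "res t v p"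
    using res_exists[OF t(1) dom_L1[OF v]] .
  with t res_op[OF t(1) v] that show thesis by blast
qed

text \<open>The resolvent keeps the bound \<open>k\<close>, so where \<open>v = k\<close> the Yosida
  approximant \<open>(v - p) / t\<close> is nonnegative; this sign survives the L1 limit.\<close>

lemma op_nonneg_at_max:
  assumes v: "v \<in> D" and "0 \<le> k" and le: "AE x in M. v x \<le> k"
  shows "AE x in M. v x = k \<longrightarrow> 0 \<le> A v x"
proof -
  \<comment> \<open>The negative part of \<open>A v\<close> on the set where \<open>v = k\<close>.
    As \<open>A p\<close> is nonnegative there, \<open>n\<close> is dominated by the Yosida
    error.\<close>
  define n where "n x = (if v x = k then max 0 (- A v x) else 0)" for x
  have [measurable]: "v \<in> borel_measurable M" "A v \<in> borel_measurable M"
    using dom_L1[OF v] op_L1[OF v] by (auto simp: L1_def)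
  have n: "n \<in> L1 M"
    unfolding L1_def mem_Collect_eq
    by (rule Bochner_Integration.integrable_bound[of M "A v"])
       (use op_L1[OF v] in \<open>auto simp: L1_def n_def[abs_def] max_def\<close>)
  have "L1_norm M n \<le> 1 * e" if "e > 0" for e
  proof -
    obtain t p where t: "0 < t" and p: "res t v p" and e: "L1_norm M (\<lambda>x. A p x - A v x) < e"
      using yosida_approx[OF v \<open>e > 0\<close>] .
    have pk: "AE x in M. p x \<le> k"
      by (rule res_le[OF t dom_L1[OF v] p \<open>0 \<le> k\<close> le])
    have "AE x in M. \<bar>n x\<bar> \<le> \<bar>A p x - A v x\<bar>"
      using pk resD(2)[OF p]
    proof eventually_elim
      fix x assume "p x \<le> k" "p x + t * A p x = v x"
      then have "v x = k \<Longrightarrow> 0 \<le> t * A p x" by linarith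
      then show "\<bar>n x\<bar> \<le> \<bar>A p x - A v x\<bar>"
        using t by (auto simp: n_def zero_le_mult_iff)
    qed
    then have "L1_norm M n \<le> L1_norm M (\<lambda>x. A p x - A v x)"
      using n op_L1[OF v] op_L1[OF resD(1)[OF p]] by (intro L1_norm_mono) (auto simp: L1_def)
    with e show ?thesis by simp
  qed
  then have "AE x in M. n x = 0"
    by (intro L1_norm_arbitrarily_small_imp_AE_eq_0[OF n, of 1]) auto
  then show ?thesis
    by eventually_elim (auto simp: n_def max_def split: if_splits)
qed

text \<open>The positive part \<open>w\<close> of \<open>v - k\<close> need not lie in
  \<open>D\<close>, so coercivity cannot be applied to it; the estimates run through its resolvent
  \<open>q\<close>, which does lie in \<open>D\<close>.\<close>

lemma max_principle:
  assumes "c > 0" and coercive: "\<And>w. w \<in> D \<Longrightarrow> c * L1_norm M w \<le> L1_norm M (A w)"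
    and v: "v \<in> D" and "0 \<le> k" and neg: "AE x in M. k < v x \<longrightarrow> A v x \<le> 0"
  shows "AE x in M. v x \<le> k"
proof -
  define w where "w x = max 0 (v x - k)" for x
  have [measurable]: "v \<in> borel_measurable M"
    using dom_L1[OF v] by (auto simp: L1_def)
  have w: "w \<in> L1 M"
    unfolding L1_def mem_Collect_eq
    by (rule Bochner_Integration.integrable_bound[of M v])
       (use dom_L1[OF v] \<open>0 \<le> k\<close> in \<open>auto simp: L1_def w_def[abs_def] max_def\<close>)
  have "L1_norm M w \<le> (8 / c + 1) * e" if "e > 0" for e
  proof -
    obtain t p where t: "0 < t" "t \<le> 1" and p: "res t v p"
      and e: "L1_norm M (\<lambda>x. A p x - A v x) < e"
      using yosida_approx[OF v \<open>e > 0\<close>] .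
    obtain q where q: "res t w q" using res_exists[OF t(1) w] .
    define h where "h x = \<bar>A p x - A v x\<bar>" for x
    have h: "h \<in> L1 M"
      using op_L1[OF v] op_L1[OF resD(1)[OF p]] by (auto simp: L1_def h_def[abs_def])
    have hnorm: "L1_norm M h < e" using e by (simp add: L1_norm_def h_def)
    have qL: "q \<in> L1 M" and AqL: "A q \<in> L1 M"
      using dom_L1 op_L1 resD(1)[OF q] by auto
    have "(\<lambda>x. v x - w x) \<in> L1 M"
      using dom_L1[OF v] w by (auto simp: L1_def)
    \<comment> \<open>\<open>v - w\<close> is the minimum of \<open>v\<close> and \<open>k\<close>,
      hence at most \<open>k\<close>.\<close>
    then have "AE x in M. p x - q x \<le> k"
      using \<open>0 \<le> k\<close> by (intro res_le[OF t(1) _ res_diff[OF p q]]) (auto simp: w_def)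
    moreover have q0: "AE x in M. 0 \<le> q x"
      by (rule res_nonneg[OF t(1) w q]) (simp add: w_def)
    ultimately have Aq: "AE x in M. A q x \<le> h x"
      using resD(2)[OF p] resD(2)[OF q] neg
    proof eventually_elim
      fix x assume x: "p x - q x \<le> k" "0 \<le> q x" "p x + t * A p x = v x" "q x + t * A q x = w x"
        "k < v x \<longrightarrow> A v x \<le> 0"
      show "A q x \<le> h x"
      proof (cases "k < v x")
        case True
        \<comment> \<open>Here \<open>w = v - k\<close>, so \<open>t * A q = v - k - q\<close>,
          which is at most \<open>v - p = t * A p\<close>.\<close>
        then have "t * A q x \<le> t * A p x" using x by (simp add: w_def)
        then have "A q x \<le> A p x" using t by simp
        then show ?thesis using x True by (simp add: h_def)
      next
        case False
        \<comment> \<open>Here \<open>w = 0\<close>, so \<open>t * A q = - q\<close>.\<close>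
        then have "t * A q x \<le> 0" using x by (simp add: w_def)
        then have "A q x \<le> 0" using t by (simp add: mult_le_0_iff)
        then show ?thesis by (simp add: h_def)
      qed
    qed
    \<comment> \<open>\<open>m\<close> is large enough for coercivity to make the norm of the resolvent at most \<open>1/2\<close>.\<close>
    define m where "m = 4 / c"
    have m: "m > 0" "m * c = 4" using \<open>c > 0\<close> by (auto simp: m_def)
    have qhL: "(\<lambda>x. q x + m * h x) \<in> L1 M" and qAL: "(\<lambda>x. q x + m * A q x) \<in> L1 M"
      using qL h AqL by (auto simp: L1_def)
    obtain r where r: "res m (\<lambda>x. q x + m * h x) r" using res_exists[OF m(1) qhL] .
    obtain s where s: "res m q s" using res_exists[OF m(1) qL] .
    have sL: "s \<in> L1 M" "A s \<in> L1 M" and rL: "r \<in> L1 M"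
      using dom_L1 op_L1 resD(1) r s by auto
    \<comment> \<open>The bound on \<open>A q\<close> is only one-sided, so coercivity applied to
      \<open>q\<close> itself would not help. Instead, \<open>q\<close> is the resolvent of
      \<open>q + m * A q\<close>, and order preservation puts it between \<open>0\<close> and
      \<open>r\<close>, which is close to \<open>s\<close>.\<close>
    have "res m (\<lambda>x. q x + m * A q x) q"
      unfolding resolvent_def using resD(1)[OF q] by simp
    then have "AE x in M. q x \<le> r x"
      by (rule res_mono[OF m(1) qAL qhL _ r]) (use Aq m(1) in auto)
    then have "L1_norm M q \<le> L1_norm M r"
      using q0 by (intro L1_norm_mono[OF qL rL]) (auto elim: eventually_elim2)
    also have "\<dots> = L1_norm M (\<lambda>x. (r x - s x) + s x)" by simp
    also have "\<dots> \<le> L1_norm M (\<lambda>x. r x - s x) + L1_norm M s"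
      using rL sL by (intro L1_norm_triangle) (auto simp: L1_def)
    also have "L1_norm M (\<lambda>x. r x - s x) \<le> m * L1_norm M h"
      using res_dist_le[OF m(1) qhL qL r s] m(1) by (simp add: L1_norm_cmult)
    finally have q1: "L1_norm M q \<le> m * L1_norm M h + L1_norm M s" by simp
    \<comment> \<open>Coercivity at \<open>s\<close>, with \<open>m * A s = q - s\<close>, shows
      that \<open>s\<close> has at most half the norm of \<open>q\<close>; that half is then
      absorbed on the left of \<open>q1\<close>.\<close>
    have "4 * L1_norm M s = m * (c * L1_norm M s)" using m by simp
    also have "\<dots> \<le> m * L1_norm M (A s)"
      using coercive[OF resD(1)[OF s]] m(1) by (intro mult_left_mono) auto
    also have "\<dots> = L1_norm M (\<lambda>x. m * A s x)"
      using m(1) by (simp add: L1_norm_cmult)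
    also have "\<dots> = L1_norm M (\<lambda>x. q x - s x)"
      using resD(2)[OF s] qL sL
      by (intro L1_norm_cong_AE) (auto simp: L1_def elim!: eventually_mono)
    also have "\<dots> \<le> L1_norm M q + L1_norm M s"
      by (rule L1_norm_triangle_diff[OF qL sL(1)])
    also have "\<dots> \<le> 2 * L1_norm M q"
      using res_norm_le[OF m(1) qL s] by simp
    finally have "L1_norm M q \<le> 2 * m * L1_norm M h" using q1 by simp
    also have "\<dots> \<le> 2 * m * e"
      using hnorm m(1) by simp
    also have "\<dots> = 8 / c * e" by (simp add: m_def)
    finally have q2: "L1_norm M q \<le> 8 / c * e" .
    \<comment> \<open>Return from \<open>q\<close> to \<open>w = q + t * A q\<close>, using
      \<open>t \<le> 1\<close>.\<close>
    have "AE x in M. \<bar>w x\<bar> \<le> \<bar>q x + h x\<bar>"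
      using Aq q0 resD(2)[OF q]
    proof eventually_elim
      fix x assume x: "A q x \<le> h x" "0 \<le> q x" "q x + t * A q x = w x"
      have "0 \<le> h x" "0 \<le> w x" by (auto simp: h_def w_def)
      have "t * A q x \<le> t * h x" using x t by simp
      also have "\<dots> \<le> 1 * h x" using t \<open>0 \<le> h x\<close> by (intro mult_right_mono) auto
      finally show "\<bar>w x\<bar> \<le> \<bar>q x + h x\<bar>" using x \<open>0 \<le> h x\<close> \<open>0 \<le> w x\<close> by simp
    qed
    then have "L1_norm M w \<le> L1_norm M (\<lambda>x. q x + h x)"
      using w qL h by (intro L1_norm_mono) (auto simp: L1_def)
    also have "\<dots> \<le> L1_norm M q + L1_norm M h"
      by (rule L1_norm_triangle[OF qL h])
    finally show ?thesis using q2 hnorm by (simp add: algebra_simps)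
  qed
  then have "AE x in M. w x = 0"
    using \<open>c > 0\<close> by (intro L1_norm_arbitrarily_small_imp_AE_eq_0[OF w, of "8 / c + 1"]) auto
  then show ?thesis
    by eventually_elim (auto simp: w_def max_def split: if_splits)
qed

end

section \<open>Application to the inclusion, via monotonicity of the graph of
  \<open>\<beta> x\<close>\<close>

theorem corollary4p8:
  fixes G :: "(real ^ 'n) set"
    and \<phi> :: "real ^ 'n \<Rightarrow> real \<Rightarrow> real"
    and \<beta> :: "real ^ 'n \<Rightarrow> real \<Rightarrow> real set"
    and D :: "(real ^ 'n \<Rightarrow> real) set"
    and A :: "(real ^ 'n \<Rightarrow> real) \<Rightarrow> real ^ 'n \<Rightarrow> real"
    and c k :: real
    and f u v b :: "real ^ 'n \<Rightarrow> real"
  assumes "open G" and "bounded G" and "connected G" and "G \<noteq> {}"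
    and "measurable_convex_integrand G (\<lambda>x r. ereal (\<phi> x r))"
    and "\<forall>x\<in>G. \<forall>r. 0 \<le> \<phi> x r"
    and "\<forall>x\<in>G. \<phi> x 0 = 0"
    and "\<forall>x\<in>G. \<forall>r. \<beta> x r = subdifferential (\<lambda>s. ereal (\<phi> x s)) r"
    and "\<forall>C>0. in_L2 (lebesgue_on G) (\<lambda>x. graph_bound (\<beta> x) C)"
    and "L1_linear_operator (lebesgue_on G) D A"
    and "L1_dense (lebesgue_on G) D"
    and "\<forall>\<mu>>0. resolvent_contraction (lebesgue_on G) D A \<mu>"
    and "c > 0"
    and "\<forall>w\<in>D. c * L1_norm (lebesgue_on G) w \<le> L1_norm (lebesgue_on G) (A w)"
    and "\<forall>g\<in>L1 (lebesgue_on G). \<forall>\<mu>>0. \<forall>w. resolvent (lebesgue_on G) D A \<mu> g w \<longrightarrow>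
           ess_sup (lebesgue_on G) w \<le> max (ess_sup (lebesgue_on G) g) 0"
    and "f \<in> L1 (lebesgue_on G)"
    and "v \<in> D" and "u \<in> L1 (lebesgue_on G)"
    and "AE x in lebesgue_on G. u x + A v x = f x"
    and "AE x in lebesgue_on G. u x \<in> \<beta> x (v x)"
    and "k \<ge> 0"
    and "b \<in> borel_measurable (lebesgue_on G)"
    and "\<forall>x\<in>G. b x \<in> \<beta> x k"
    and "AE x in lebesgue_on G. f x \<le> b x"
  shows "AE x in lebesgue_on G. v x \<le> k \<and> u x \<le> b x"
proof -
  let ?M = "lebesgue_on G"
  interpret sub_markovian_operator ?M D A
    using assms(10-12,15) by unfold_locales auto
  have in_G: "AE x in ?M. x \<in> G"
    by (rule AE_I2) simp
  have mono: "a \<le> a'" if "x \<in> G" "r < s" "a \<in> \<beta> x r" "a' \<in> \<beta> x s" for x r s a a'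
    using that assms(8) by (auto intro: subdifferential_mono)
  have "AE x in ?M. k < v x \<longrightarrow> A v x \<le> 0"
    using in_G assms(19,20,24)
  proof eventually_elim
    fix x assume x: "x \<in> G" "u x + A v x = f x" "u x \<in> \<beta> x (v x)" "f x \<le> b x"
    \<comment> \<open>Monotonicity gives \<open>b \<le> u\<close> here, so
      \<open>A v = f - u\<close> is at most \<open>f - b\<close>.\<close>
    show "k < v x \<longrightarrow> A v x \<le> 0"
      using mono[of x k "v x" "b x" "u x"] x assms(23) by auto
  qed
  then have le: "AE x in ?M. v x \<le> k"
    using assms(14) by (intro max_principle[OF \<open>c > 0\<close> _ \<open>v \<in> D\<close> \<open>k \<ge> 0\<close>]) auto
  show ?thesis
    using in_G le op_nonneg_at_max[OF \<open>v \<in> D\<close> \<open>k \<ge> 0\<close> le] assms(19,20,24)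
  proof eventually_elim
    fix x assume x: "x \<in> G" "v x \<le> k" "v x = k \<longrightarrow> 0 \<le> A v x"
      "u x + A v x = f x" "u x \<in> \<beta> x (v x)" "f x \<le> b x"
    \<comment> \<open>Monotonicity settles \<open>v < k\<close>. At \<open>v = k\<close> both
      \<open>u\<close> and \<open>b\<close> lie in the same set \<open>\<beta> x k\<close> and it
      says nothing; the sign of \<open>A v\<close> decides instead.\<close>
    then show "v x \<le> k \<and> u x \<le> b x"
      using mono[of x "v x" k "u x" "b x"] assms(23) by (cases "v x = k") auto
  qed
qed

end
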